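(* Every parenthesized braid $x$ (element of $B_\bullet$) admits decompositions $$x=\partial^{q-1}z_q'^{-1}\cdots\partial z_2'^{-1}\cdot z_1'^{-1}\cdot z_1\cdot\partial z_2\cdots\partial^{p-1}z_p,$$ $$x=\partial^{n-1}h_n'^{-1}\cdots h_1'^{-1}\cdot\partial^{n-1}\beta_n'^{-1}\cdots\beta_1'^{-1}\cdot\beta_1\cdots\partial^{n-1}\beta_n\cdot h_1\cdots\partial^{n-1}h_n,$$ where $z_1,\dots,z_p,z'_1,\dots,z_q'$ are special parenthesized braids, $\beta_1,\dots,\beta_n,\beta_1',\dots,\beta_n'$ are special braids, and $h_1,\dots,h_n,h'_1,\dots,h_n'$ are special Thompson elements (the $k$-th factor in each family being shifted by $\partial^{k-1}$).
   Context: $B_\bullet$ is the group (of parenthesized braids) presented by generators $\sigma_i,a_i$ ($i\ge1$) and the relations, for all $i\ge1$ and $j\ge i+2$: $\sigma_i\sigma_j=\sigma_j\sigma_i$, $\sigma_ia_j=a_j\sigma_i$, $a_ia_{j-1}=a_ja_i$, $a_i\sigma_{j-1}=\sigma_ja_i$, $\sigma_i\sigma_{i+1}\sigma_i=\sigma_{i+1}\sigma_i\sigma_{i+1}$, $\sigma_{i+1}\sigma_ia_{i+1}=a_i\sigma_i$, $\sigma_i\sigma_{i+1}a_i=a_{i+1}\sigma_i$. The map $\partial$ is the injective endomorphism with $\sigma_i\mapsto\sigma_{i+1}$, $a_i\mapsto a_{i+1}$. Put $x\lceil y\rceil=x\cdot\partial y\cdot\sigma_1\cdot(\partial x)^{-1}$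 and $x\circ y=x\cdot\partial y\cdot a_1$. A special braid (resp. special Thompson element, resp. special parenthesized braid) is an element of the closure of $\{1\}$ in $B_\bullet$ under the bracket operation (resp. under $\circ$, resp. under both the bracket and $\circ$). *)

theory Defs
  imports Main
begin

section \<open>Group presentations\<close>

text \<open>Group words: the letter \<open>(g, True)\<close> stands for \<open>g\<close>, and \<open>(g, False)\<close> for its formal inverse.\<close>

type_synonym 'g gword = "('g \<times> bool) list"

definition word_inv :: "'g gword \<Rightarrow> 'g gword" where
  "word_inv w = rev (map (\<lambda>(g, e). (g, \<not> e)) w)"

text \<open>\<open>pres_cong R\<close> is the congruence on group words whose classes form the group with
  relations \<open>u = v\<close> for \<open>R u v\<close>.\<close>

inductive pres_cong :: "('g gword \<Rightarrow> 'g gword \<Rightarrow> bool) \<Rightarrow> 'g gword \<Rightarrow> 'g gword \<Rightarrow> bool"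
  for R where
  rel: "R u v \<Longrightarrow> pres_cong R u v"
| cancel: "pres_cong R [(g, e), (g, \<not> e)] []"
| refl: "pres_cong R u u"
| sym: "pres_cong R u v \<Longrightarrow> pres_cong R v u"
| trans: "pres_cong R u v \<Longrightarrow> pres_cong R v w \<Longrightarrow> pres_cong R u w"
| append: "pres_cong R u u' \<Longrightarrow> pres_cong R v v' \<Longrightarrow> pres_cong R (u @ v) (u' @ v')"

lemma equivp_pres_cong: "equivp (pres_cong R)"
  by (rule equivpI)
    (auto intro!: reflpI sympI transpI intro: pres_cong.refl pres_cong.sym pres_cong.trans)

lemma word_inv_append: "word_inv (u @ v) = word_inv v @ word_inv u"
  by (simp add: word_inv_def)

lemma word_inv_word_inv [simp]: "word_inv (word_inv u) = u"
  by (simp add: word_inv_def rev_map comp_def case_prod_unfold)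

lemma pres_cong_right_inv: "pres_cong R (u @ word_inv u) []"
proof (induction u)
  case Nil
  then show ?case by (simp add: word_inv_def pres_cong.refl)
next
  case (Cons x u)
  obtain g e where x: "x = (g, e)" by force
  have "pres_cong R ([(g, e)] @ (u @ word_inv u) @ [(g, \<not> e)]) ([(g, e)] @ [] @ [(g, \<not> e)])"
    by (intro pres_cong.append pres_cong.refl Cons.IH)
  then have "pres_cong R ([(g, e)] @ (u @ word_inv u) @ [(g, \<not> e)]) []"
    by (rule pres_cong.trans) (simp add: pres_cong.cancel)
  then show ?case by (simp add: x word_inv_def)
qed

lemma pres_cong_left_inv: "pres_cong R (word_inv u @ u) []"
  using pres_cong_right_inv[of R "word_inv u"] by simp

lemma pres_cong_word_inv:
  assumes "pres_cong R u v"
  shows "pres_cong R (word_inv u) (word_inv v)"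
proof -
  have 1: "pres_cong R (word_inv u @ v @ word_inv v) (word_inv u @ [])"
    by (intro pres_cong.append pres_cong.refl pres_cong_right_inv)
  have 2: "pres_cong R (word_inv u @ v @ word_inv v) (word_inv u @ u @ word_inv v)"
    by (intro pres_cong.append pres_cong.refl pres_cong.sym[OF assms])
  have 3: "pres_cong R ((word_inv u @ u) @ word_inv v) ([] @ word_inv v)"
    by (intro pres_cong.append pres_cong.refl pres_cong_left_inv)
  from pres_cong.trans[OF pres_cong.sym[OF 1] pres_cong.trans[OF 2]] 3 show ?thesis
    by simp
qed


section \<open>The group of parenthesized braids\<close>

text \<open>Indices start from \<open>0\<close>: \<open>Sig i\<close> and \<open>Aa i\<close> are the generators usually written
  \<open>\<sigma>\<close> and \<open>a\<close> with index \<open>i + 1\<close>. The relations are invariant under this translation.\<close>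

datatype pb_gen = Sig nat | Aa nat

abbreviation pos :: "pb_gen list \<Rightarrow> pb_gen gword" where
  "pos gs \<equiv> map (\<lambda>g. (g, True)) gs"

inductive pb_rel :: "pb_gen gword \<Rightarrow> pb_gen gword \<Rightarrow> bool" where
  "j \<ge> i + 2 \<Longrightarrow> pb_rel (pos [Sig i, Sig j]) (pos [Sig j, Sig i])"
| "j \<ge> i + 2 \<Longrightarrow> pb_rel (pos [Sig i, Aa j]) (pos [Aa j, Sig i])"
| "j \<ge> i + 2 \<Longrightarrow> pb_rel (pos [Aa i, Aa (j - 1)]) (pos [Aa j, Aa i])"
| "j \<ge> i + 2 \<Longrightarrow> pb_rel (pos [Aa i, Sig (j - 1)]) (pos [Sig j, Aa i])"
| "pb_rel (pos [Sig i, Sig (i + 1), Sig i]) (pos [Sig (i + 1), Sig i, Sig (i + 1)])"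
| "pb_rel (pos [Sig (i + 1), Sig i, Aa (i + 1)]) (pos [Aa i, Sig i])"
| "pb_rel (pos [Sig i, Sig (i + 1), Aa i]) (pos [Aa (i + 1), Sig i])"

quotient_type pbraid = "pb_gen gword" / "pres_cong pb_rel"
  by (rule equivp_pres_cong)

instantiation pbraid :: "{monoid_mult, inverse}"
begin

lift_definition one_pbraid :: pbraid is "[]" .

lift_definition times_pbraid :: "pbraid \<Rightarrow> pbraid \<Rightarrow> pbraid" is "(@)"
  by (rule pres_cong.append)

lift_definition inverse_pbraid :: "pbraid \<Rightarrow> pbraid" is word_inv
  by (rule pres_cong_word_inv)

definition divide_pbraid :: "pbraid \<Rightarrow> pbraid \<Rightarrow> pbraid" where
  "divide_pbraid x y = x * inverse y"

instance
  by standard (transfer, simp add: pres_cong.refl)+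

end

interpretation pbraid: group times "1 :: pbraid" inverse
proof
  fix x :: pbraid
  show "1 * x = x" by simp
  show "inverse x * x = 1" by transfer (rule pres_cong_left_inv)
qed

lift_definition pb_sigma :: "nat \<Rightarrow> pbraid" is "\<lambda>i. pos [Sig i]" .

lift_definition pb_a :: "nat \<Rightarrow> pbraid" is "\<lambda>i. pos [Aa i]" .

fun shift_gen :: "pb_gen \<Rightarrow> pb_gen" where
  "shift_gen (Sig i) = Sig (Suc i)"
| "shift_gen (Aa i) = Aa (Suc i)"

lemma pb_rel_shift:
  assumes "pb_rel u v"
  shows "pb_rel (map (apfst shift_gen) u) (map (apfst shift_gen) v)"
  using assms
proof cases
  case (3 j i)
  then show ?thesis using pb_rel.intros(3)[of "Suc i" "Suc j"] by (simp add: Suc_diff_Suc)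
next
  case (4 j i)
  then show ?thesis using pb_rel.intros(4)[of "Suc i" "Suc j"] by (simp add: Suc_diff_Suc)
qed (use pb_rel.intros(1,2,5-) in fastforce)+

lift_definition pb_shift :: "pbraid \<Rightarrow> pbraid" is "map (apfst shift_gen)"
proof -
  fix u v :: "pb_gen gword"
  assume "pres_cong pb_rel u v"
  then show "pres_cong pb_rel (map (apfst shift_gen) u) (map (apfst shift_gen) v)"
    by induction
      (auto intro: pres_cong.intros pb_rel_shift)
qed

lemma pb_shift_mult: "pb_shift (x * y) = pb_shift x * pb_shift y"
  by transfer (simp add: pres_cong.refl)

lemma pb_shift_sigma: "pb_shift (pb_sigma i) = pb_sigma (Suc i)"
  by transfer (simp add: pres_cong.refl)

lemma pb_shift_a: "pb_shift (pb_a i) = pb_a (Suc i)"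
  by transfer (simp add: pres_cong.refl)


section \<open>Special elements\<close>

definition pb_bracket :: "pbraid \<Rightarrow> pbraid \<Rightarrow> pbraid" where
  "pb_bracket x y = x * pb_shift y * pb_sigma 0 * inverse (pb_shift x)"

definition pb_circ :: "pbraid \<Rightarrow> pbraid \<Rightarrow> pbraid" where
  "pb_circ x y = x * pb_shift y * pb_a 0"

inductive_set special_braids :: "pbraid set" where
  "1 \<in> special_braids"
| "x \<in> special_braids \<Longrightarrow> y \<in> special_braids \<Longrightarrow> pb_bracket x y \<in> special_braids"

inductive_set special_thompson :: "pbraid set" where
  "1 \<in> special_thompson"
| "x \<in> special_thompson \<Longrightarrow> y \<in> special_thompson \<Longrightarrow> pb_circ x y \<in> special_thompson"

inductive_set special_pbraids :: "pbraid set" where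
  "1 \<in> special_pbraids"
| "x \<in> special_pbraids \<Longrightarrow> y \<in> special_pbraids \<Longrightarrow> pb_bracket x y \<in> special_pbraids"
| "x \<in> special_pbraids \<Longrightarrow> y \<in> special_pbraids \<Longrightarrow> pb_circ x y \<in> special_pbraids"

text \<open>With \<open>\<partial>\<close> the shift: \<open>asc_prod z n\<close> is
  \<open>z 1 * \<partial> (z 2) * \<dots> * \<partial>\<^sup>n\<^sup>-\<^sup>1 (z n)\<close> and \<open>desc_inv_prod z n\<close> is
  \<open>\<partial>\<^sup>n\<^sup>-\<^sup>1 (inverse (z n)) * \<dots> * \<partial> (inverse (z 2)) * inverse (z 1)\<close>.\<close>

definition asc_prod :: "(nat \<Rightarrow> pbraid) \<Rightarrow> nat \<Rightarrow> pbraid" where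
  "asc_prod z n = prod_list (map (\<lambda>k. (pb_shift ^^ (k - 1)) (z k)) [1..<Suc n])"

definition desc_inv_prod :: "(nat \<Rightarrow> pbraid) \<Rightarrow> nat \<Rightarrow> pbraid" where
  "desc_inv_prod z n =
     prod_list (map (\<lambda>k. (pb_shift ^^ (k - 1)) (inverse (z k))) (rev [1..<Suc n]))"

end

theory Submission imports Defs begin

text \<open>Write \<open>B\<close>, \<open>T\<close> for the submonoids generated by the \<open>\<sigma>\<^sub>i\<close>, resp. the \<open>a\<^sub>i\<close>, and
  \<open>S\<close> for the subgroup generated by the \<open>\<sigma>\<^sub>i\<close>. The relations allow one to move a letter \<open>a\<^sub>i\<close> to
  the right of a braid (changing the index), so \<open>T S \<subseteq> S T\<close>; they give \<open>T T\<^sup>-\<^sup>1 \<subseteq> T\<^sup>-\<^sup>1 T\<close>,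
  and Garside's fundamental braids give \<open>S = B\<^sup>-\<^sup>1 B\<close>. Hence the whole group is
  \<open>T\<^sup>-\<^sup>1 B\<^sup>-\<^sup>1 B T\<close>. Finally \<open>x * \<partial> y * \<sigma>\<^sub>1 = x[y] * \<partial> x\<close> and \<open>x * \<partial> y * a\<^sub>1 = x \<circ> y\<close>, while \<open>\<sigma>\<^sub>1\<close>
  commutes with \<open>\<partial>\<^sup>2 z\<close> and \<open>\<partial>\<^sup>2 z * a\<^sub>1 = a\<^sub>1 * \<partial> z\<close>; so the products
  \<open>z\<^sub>1 * \<partial> z\<^sub>2 * \<partial>\<^sup>2 z\<^sub>3 * \<dots>\<close> of special elements are stable under right multiplication by
  \<open>\<sigma>\<^sub>i\<close> and \<open>a\<^sub>i\<close>, and therefore exhaust the positive elements.\<close>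

section \<open>Generated submonoids\<close>

text \<open>Letters are appended on the right only, so induction strips the last letter; most
  arguments below follow an element under right multiplication by one letter.\<close>

inductive_set submonoid_gen :: "'a::monoid_mult set \<Rightarrow> 'a set" for X where
  one: "1 \<in> submonoid_gen X"
| step: "x \<in> submonoid_gen X \<Longrightarrow> g \<in> X \<Longrightarrow> x * g \<in> submonoid_gen X"

lemma submonoid_gen_incl: "g \<in> X \<Longrightarrow> g \<in> submonoid_gen X"
  using submonoid_gen.step[OF submonoid_gen.one] by fastforce

lemma submonoid_gen_mult:
  assumes "x \<in> submonoid_gen X" "y \<in> submonoid_gen X"
  shows "x * y \<in> submonoid_gen X"
  using assms(2) by induction (auto simp: assms(1) mult.assoc[symmetric] intro: submonoid_gen.step)

lemma submonoid_gen_mono: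
  assumes "X \<subseteq> Y"
  shows "submonoid_gen X \<subseteq> submonoid_gen Y"
proof
  fix x assume "x \<in> submonoid_gen X"
  then show "x \<in> submonoid_gen Y"
    by induction (use assms in \<open>auto intro: submonoid_gen.intros\<close>)
qed

section \<open>Relations in the group of parenthesized braids\<close>

lemma pb_rel_eq:
  "j \<ge> i + 2 \<Longrightarrow> pb_sigma i * pb_sigma j = pb_sigma j * pb_sigma i"
  "j \<ge> i + 2 \<Longrightarrow> pb_sigma i * pb_a j = pb_a j * pb_sigma i"
  "j \<ge> i + 2 \<Longrightarrow> pb_a i * pb_a (j - 1) = pb_a j * pb_a i"
  "j \<ge> i + 2 \<Longrightarrow> pb_a i * pb_sigma (j - 1) = pb_sigma j * pb_a i"
  "pb_sigma i * pb_sigma (i + 1) * pb_sigma i = pb_sigma (i + 1) * pb_sigma i * pb_sigma (i + 1)"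
  "pb_sigma (i + 1) * pb_sigma i * pb_a (i + 1) = pb_a i * pb_sigma i"
  "pb_sigma i * pb_sigma (i + 1) * pb_a i = pb_a (i + 1) * pb_sigma i"
  using pb_rel.intros
  by (transfer, fastforce intro: pres_cong.rel)+

lemma pb_a_a: "i < k \<Longrightarrow> pb_a i * pb_a k = pb_a (Suc k) * pb_a i"
  using pb_rel_eq(3)[of i "Suc k"] by simp

lemma pb_a_sigma: "i < k \<Longrightarrow> pb_a i * pb_sigma k = pb_sigma (Suc k) * pb_a i"
  using pb_rel_eq(4)[of i "Suc k"] by simp

text \<open>A common multiple turns a right fraction into a left one. This is the main tool below
  for moving an inverse letter to the left.\<close>

lemma pbraid_inverse_conj:
  assumes "u * v = w * (u'::pbraid)"
  shows "u' * inverse v = inverse w * u"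
proof -
  have "inverse w * (u * v) * inverse v = inverse w * (w * u') * inverse v"
    by (simp only: assms)
  moreover have "inverse w * (u * v) * inverse v = inverse w * u * (v * inverse v)"
    "inverse w * (w * u') * inverse v = (inverse w * w) * (u' * inverse v)"
    by (simp_all only: mult.assoc)
  ultimately show ?thesis by simp
qed

lemma pb_shift_1 [simp]: "pb_shift 1 = 1"
  by transfer (simp add: pres_cong.refl)

lemma pb_shift_inverse: "pb_shift (inverse x) = inverse (pb_shift x)"
  by (metis pb_shift_1 pb_shift_mult pbraid.inverse_unique pbraid.right_inverse)

abbreviation pb_letters :: "pbraid set" where
  "pb_letters \<equiv> range pb_sigma \<union> inverse ` range pb_sigma \<union> range pb_a \<union> inverse ` range pb_a"

lemma submonoid_gen_pb_letters: "x \<in> submonoid_gen pb_letters"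
proof -
  have "abs_pbraid w \<in> submonoid_gen pb_letters" for w
  proof (induction w rule: rev_induct)
    case Nil
    have "abs_pbraid [] = 1" by (simp add: one_pbraid.abs_eq)
    then show ?case by (simp add: submonoid_gen.one)
  next
    case (snoc l w)
    obtain g e where l: "l = (g, e)" by force
    have "abs_pbraid [(g, e)] \<in> pb_letters"
      by (cases g; cases e)
        (auto simp: pb_sigma.abs_eq pb_a.abs_eq inverse_pbraid.abs_eq word_inv_def image_iff)
    then have "abs_pbraid w * abs_pbraid [(g, e)] \<in> submonoid_gen pb_letters"
      by (rule submonoid_gen.step[OF snoc.IH])
    then show ?case by (simp add: l times_pbraid.abs_eq)
  qed
  then show ?thesis by (induction x rule: pbraid.abs_induct)
qed

lemma pbraid_induct [case_names one sigma sigma_inv a a_inv]: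
  assumes "P 1"
    and "\<And>x i. P x \<Longrightarrow> P (x * pb_sigma i)" "\<And>x i. P x \<Longrightarrow> P (x * inverse (pb_sigma i))"
    and "\<And>x i. P x \<Longrightarrow> P (x * pb_a i)" "\<And>x i. P x \<Longrightarrow> P (x * inverse (pb_a i))"
  shows "P x"
  using submonoid_gen_pb_letters[of x]
  by induction (use assms in auto)

text \<open>As \<open>f\<close> and \<open>g\<close> are multiplicative, the identity passes to
  products and inverses, so it is enough to check the generators.\<close>

lemma pb_conj_shift:
  assumes "\<And>i. f (pb_sigma i) * u = u * g (pb_sigma i)" "\<And>i. f (pb_a i) * u = u * g (pb_a i)"
    and f: "\<And>x y. f (x * y) = f x * f y" and g: "\<And>x y. g (x * y) = g x * g y"
  shows "f x * u = u * (g x :: pbraid)"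
proof -
  have one: "f 1 = 1" "g 1 = 1"
    using f[of 1 1] g[of 1 1] pbraid.left_cancel[of "f 1" "f 1" 1] pbraid.left_cancel[of "g 1" "g 1" 1]
    by auto
  have inv: "f (inverse y) = inverse (f y)" "g (inverse y) = inverse (g y)" for y
    by (metis f g one pbraid.inverse_unique pbraid.right_inverse)+
  have step: "f (x * y) * u = u * g (x * y)" if "f x * u = u * g x" "f y * u = u * g y" for x y
    by (metis f g mult.assoc that)
  have step_inv: "f (inverse y) * u = u * g (inverse y)" if "f y * u = u * g y" for y
    using pbraid_inverse_conj[of u "g y" "f y" u] that by (simp add: inv)
  show ?thesis
    by (induction x rule: pbraid_induct) (auto simp: one intro!: step step_inv assms(1,2))
qed

lemma pb_shift2_sigma: "pb_shift (pb_shift x) * pb_sigma 0 = pb_sigma 0 * pb_shift (pb_shift x)"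
  by (rule pb_conj_shift[where f = "\<lambda>x. pb_shift (pb_shift x)" and g = "\<lambda>x. pb_shift (pb_shift x)"])
    (simp_all add: pb_shift_sigma pb_shift_a pb_shift_mult pb_rel_eq(1,2)[symmetric])

lemma pb_shift2_a: "pb_shift (pb_shift x) * pb_a 0 = pb_a 0 * pb_shift x"
  by (rule pb_conj_shift[where f = "\<lambda>x. pb_shift (pb_shift x)" and g = "pb_shift"])
    (simp_all add: pb_shift_sigma pb_shift_a pb_shift_mult pb_a_a pb_a_sigma)

section \<open>Garside's fundamental braids\<close>

abbreviation pos_braids :: "pbraid set" where
  "pos_braids \<equiv> submonoid_gen (range pb_sigma)"

abbreviation pos_braids_below :: "nat \<Rightarrow> pbraid set" where
  "pos_braids_below n \<equiv> submonoid_gen (pb_sigma ` {..<n})"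

lemma pos_braids_below_mono: "m \<le> n \<Longrightarrow> x \<in> pos_braids_below m \<Longrightarrow> x \<in> pos_braids_below n"
  using submonoid_gen_mono[of "pb_sigma ` {..<m}" "pb_sigma ` {..<n}"] by fastforce

lemma pos_braids_below_pos_braids: "x \<in> pos_braids_below n \<Longrightarrow> x \<in> pos_braids"
  using submonoid_gen_mono[of "pb_sigma ` {..<n}" "range pb_sigma"] by fastforce

text \<open>Needed because a fundamental braid only handles indices below a bound.\<close>

lemma pos_braids_bounded: "x \<in> pos_braids \<Longrightarrow> \<exists>n. x \<in> pos_braids_below n"
proof (induction rule: submonoid_gen.induct)
  case one
  show ?case by (auto intro: submonoid_gen.one)
next
  case (step x g)
  then obtain n i where "x \<in> pos_braids_below n" "g = pb_sigma i" by auto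
  then have "x * g \<in> pos_braids_below (max n (Suc i))"
    by (intro submonoid_gen.step pos_braids_below_mono[of n "max n (Suc i)"]) auto
  then show ?case by blast
qed

lemma pos_braids_below_commute:
  assumes "x \<in> pos_braids_below n" "n < m"
  shows "x * pb_sigma m = pb_sigma m * x"
  using assms(1)
proof induction
  case (step x g)
  then obtain i where i: "i < n" "g = pb_sigma i" by auto
  then have "g * pb_sigma m = pb_sigma m * g" using pb_rel_eq(1)[of i m] assms(2) by simp
  then show ?case by (metis step.IH mult.assoc)
qed simp

lemma pos_braids_below_shift:
  assumes "x \<in> pos_braids_below n"
  shows "pb_shift x \<in> pos_braids_below (Suc n)"
  using assms
  by induction (auto simp: pb_shift_mult pb_shift_sigma intro!: submonoid_gen.intros)

text \<open>The braid \<open>pb_sigma 0 * ... * pb_sigma (n - 1)\<close>, which carries one strand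
  across \<open>n\<close> others.\<close>

fun pb_sweep :: "nat \<Rightarrow> pbraid" where
  "pb_sweep 0 = 1"
| "pb_sweep (Suc n) = pb_sweep n * pb_sigma n"

text \<open>Garside's half twist on \<open>n + 1\<close> strands, written as a product of sweeps of
  decreasing length.\<close>

fun pb_Delta :: "nat \<Rightarrow> pbraid" where
  "pb_Delta 0 = 1"
| "pb_Delta (Suc n) = pb_sweep (Suc n) * pb_Delta n"

lemma pb_sweep_below: "pb_sweep n \<in> pos_braids_below n"
proof (induction n)
  case (Suc n)
  then show ?case by (auto intro!: submonoid_gen.step intro: pos_braids_below_mono[of n])
qed (simp add: submonoid_gen.one)

lemma pb_Delta_below: "pb_Delta n \<in> pos_braids_below n"
proof (induction n)
  case (Suc n)
  then show ?case
    using submonoid_gen_mult[OF pb_sweep_below pos_braids_below_mono[of n "Suc n"]] by simp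
qed (simp add: submonoid_gen.one)

text \<open>The braid relation is applied where \<open>pb_sigma (j + 1)\<close> has just been
  appended to the sweep; all letters appended later commute with \<open>pb_sigma j\<close>.\<close>

lemma pb_sweep_sigma: "Suc j < n \<Longrightarrow> pb_sweep n * pb_sigma j = pb_sigma (Suc j) * pb_sweep n"
proof (induction n)
  case (Suc n)
  show ?case
  proof (cases "Suc j < n")
    case True
    then have "pb_sweep n * pb_sigma j = pb_sigma (Suc j) * pb_sweep n"
      "pb_sigma j * pb_sigma n = pb_sigma n * pb_sigma j"
      using Suc.IH pb_rel_eq(1)[of j n] by simp_all
    then show ?thesis by (metis mult.assoc pb_sweep.simps(2))
  next
    case False
    then have n: "n = Suc j" using Suc.prems by simp
    have "pb_sweep (Suc n) * pb_sigma j
        = pb_sweep j * (pb_sigma j * pb_sigma (j + 1) * pb_sigma j)"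
      by (simp add: n mult.assoc)
    also have "\<dots> = (pb_sweep j * pb_sigma (j + 1)) * pb_sigma j * pb_sigma (j + 1)"
      by (subst pb_rel_eq(5)) (simp only: mult.assoc)
    also have "pb_sweep j * pb_sigma (j + 1) = pb_sigma (j + 1) * pb_sweep j"
      by (rule pos_braids_below_commute[OF pb_sweep_below]) simp
    finally show ?thesis by (simp add: n mult.assoc)
  qed
qed simp

lemma pb_sweep_shift:
  assumes "x \<in> pos_braids_below n"
  shows "pb_sweep (Suc n) * x = pb_shift x * pb_sweep (Suc n)"
  using assms
proof induction
  case (step x g)
  then obtain i where "i < n" "g = pb_sigma i" by auto
  then have "pb_sweep (Suc n) * g = pb_shift g * pb_sweep (Suc n)"
    by (metis Suc_mono pb_shift_sigma pb_sweep_sigma)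
  then show ?case by (metis step.IH mult.assoc pb_shift_mult)
qed simp

lemma pb_sweep_Suc: "pb_sweep (Suc n) = pb_sigma 0 * pb_shift (pb_sweep n)"
proof (induction n)
  case (Suc n)
  have "pb_sweep (Suc (Suc n)) = pb_sweep (Suc n) * pb_sigma (Suc n)" by simp
  also have "\<dots> = pb_sigma 0 * pb_shift (pb_sweep n * pb_sigma n)"
    by (simp only: Suc.IH pb_shift_mult pb_shift_sigma mult.assoc)
  finally show ?case by simp
qed simp

text \<open>Serves the top index in \<open>pb_Delta_sigma\<close>, where two equal sweeps arise and
  one of them must be shortened.\<close>

lemma pb_sweep_square: "pb_sweep (Suc n) * pb_sweep (Suc n) = pb_sigma 0 * (pb_sweep (Suc n) * pb_sweep n)"
proof -
  have "pb_sigma 0 * (pb_sweep (Suc n) * pb_sweep n)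
      = (pb_sigma 0 * pb_shift (pb_sweep n)) * pb_sweep (Suc n)"
    by (simp only: pb_sweep_shift[OF pb_sweep_below] mult.assoc)
  then show ?thesis by (simp only: pb_sweep_Suc[symmetric])
qed

text \<open>Conjugation by the half twist reverses the indices. Below the top index, the induction
  hypothesis reverses and the outer sweep then raises the result by one; the top index comes from
  \<open>pb_sweep_square\<close>.\<close>

lemma pb_Delta_sigma: "i < n \<Longrightarrow> pb_Delta n * pb_sigma i = pb_sigma (n - Suc i) * pb_Delta n"
proof (induction n)
  case (Suc n)
  show ?case
  proof (cases "i < n")
    case True
    then have "pb_Delta (Suc n) * pb_sigma i
        = pb_sweep (Suc n) * pb_sigma (n - Suc i) * pb_Delta n"
      using Suc.IH by (simp add: mult.assoc)
    also have "pb_sweep (Suc n) * pb_sigma (n - Suc i)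
        = pb_sigma (Suc (n - Suc i)) * pb_sweep (Suc n)"
      using True by (intro pb_sweep_sigma) simp
    also have "Suc (n - Suc i) = Suc n - Suc i" using True by simp
    finally show ?thesis by (simp add: mult.assoc)
  next
    case False
    then have i: "i = n" using Suc.prems by simp
    show ?thesis
    proof (cases n)
      case (Suc m)
      have "pb_Delta (Suc n) * pb_sigma n
          = pb_sweep (Suc n) * (pb_sweep n * (pb_Delta m * pb_sigma n))"
        using Suc by (simp add: mult.assoc)
      also have "pb_Delta m * pb_sigma n = pb_sigma n * pb_Delta m"
        using Suc by (intro pos_braids_below_commute[OF pb_Delta_below]) simp
      also have "pb_sweep (Suc n) * (pb_sweep n * (pb_sigma n * pb_Delta m))
          = (pb_sweep (Suc n) * pb_sweep (Suc n)) * pb_Delta m"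
        by (simp add: mult.assoc)
      also have "\<dots> = pb_sigma 0 * pb_Delta (Suc n)"
        unfolding pb_sweep_square using Suc by (simp add: mult.assoc)
      finally show ?thesis by (simp add: i)
    qed (simp add: i)
  qed
qed simp

lemma pb_Delta_right_divisible: "i < n \<Longrightarrow> \<exists>u\<in>pos_braids. pb_Delta n = u * pb_sigma i"
proof (induction n)
  case (Suc n)
  show ?case
  proof (cases "i < n")
    case True
    then obtain u where "u \<in> pos_braids" "pb_Delta n = u * pb_sigma i" using Suc.IH by blast
    then show ?thesis
      using submonoid_gen_mult[OF pos_braids_below_pos_braids[OF pb_sweep_below[of "Suc n"]]]
      by (intro bexI[of _ "pb_sweep (Suc n) * u"]) (simp_all add: mult.assoc)
  next
    case False
    then have i: "i = n" using Suc.prems by simp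
    \<comment> \<open>Moving the outer sweep to the right of \<open>pb_Delta n\<close> shifts the
      latter and exposes the last letter of the sweep.\<close>
    have "pb_Delta (Suc n) = pb_shift (pb_Delta n) * pb_sweep n * pb_sigma i"
      using pb_sweep_shift[OF pb_Delta_below, of n] by (simp add: i mult.assoc)
    moreover have "pb_shift (pb_Delta n) * pb_sweep n \<in> pos_braids"
      by (meson submonoid_gen_mult pos_braids_below_pos_braids pb_sweep_below pb_Delta_below
          pos_braids_below_shift)
    ultimately show ?thesis by blast
  qed
qed simp

lemma pb_Delta_conj:
  assumes "x \<in> pos_braids_below n"
  shows "\<exists>y\<in>pos_braids. pb_Delta n * x = y * pb_Delta n"
  using assms
proof induction
  case one
  show ?case by (intro bexI[of _ 1]) (simp_all add: submonoid_gen.one)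
next
  case (step x g)
  then obtain y i where y: "y \<in> pos_braids" "pb_Delta n * x = y * pb_Delta n"
    and i: "i < n" "g = pb_sigma i" by auto
  have "pb_Delta n * (x * g) = y * pb_sigma (n - Suc i) * pb_Delta n"
    using y(2) pb_Delta_sigma[OF i(1)] i(2) by (metis mult.assoc)
  then show ?case using y(1) by (auto intro: submonoid_gen.step)
qed

text \<open>For large \<open>n\<close>, \<open>x\<close> crosses \<open>pb_Delta n\<close> and stays
  positive, while \<open>pb_Delta n\<close> is right divisible by \<open>pb_sigma k\<close>. So the
  inverse letter cancels, at the price of the denominator \<open>pb_Delta n\<close>.\<close>

lemma pos_braid_times_inverse_sigma:
  assumes "x \<in> pos_braids"
  shows "\<exists>b\<in>pos_braids. \<exists>c\<in>pos_braids. x * inverse (pb_sigma k) = inverse b * c"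
proof -
  obtain m where "x \<in> pos_braids_below m" using pos_braids_bounded[OF assms] by blast
  then have "x \<in> pos_braids_below (m + Suc k)"
    by (rule pos_braids_below_mono[rotated]) simp
  then obtain n where n: "x \<in> pos_braids_below n" "k < n"
    by (rule that) simp
  obtain y where y: "y \<in> pos_braids" "pb_Delta n * x = y * pb_Delta n"
    using pb_Delta_conj[OF n(1)] by blast
  obtain u where u: "u \<in> pos_braids" "pb_Delta n = u * pb_sigma k"
    using pb_Delta_right_divisible[OF n(2)] by blast
  have "pb_Delta n * x = (y * u) * pb_sigma k" using y(2) u(2) by (simp add: mult.assoc)
  from pbraid_inverse_conj[OF this[symmetric]]
  have "x * inverse (pb_sigma k) = inverse (pb_Delta n) * (y * u)" .
  then show ?thesis
    using submonoid_gen_mult[OF y(1) u(1)] pos_braids_below_pos_braids[OF pb_Delta_below] by blast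
qed

section \<open>Braids as left fractions of positive braids\<close>

abbreviation braids :: "pbraid set" where
  "braids \<equiv> submonoid_gen (range pb_sigma \<union> inverse ` range pb_sigma)"

lemma braid_fraction:
  assumes "x \<in> braids"
  shows "\<exists>b\<in>pos_braids. \<exists>c\<in>pos_braids. x = inverse b * c"
  using assms
proof induction
  case one
  show ?case by (intro bexI[of _ 1]) (simp_all add: submonoid_gen.one)
next
  case (step x g)
  then obtain b c where bc: "b \<in> pos_braids" "c \<in> pos_braids" "x = inverse b * c" by blast
  from step.hyps(2) consider i where "g = pb_sigma i" | i where "g = inverse (pb_sigma i)" by blast
  then show ?case
  proof cases
    case 1
    then have "x * g = inverse b * (c * g)" "c * g \<in> pos_braids"
      using bc by (auto simp: mult.assoc intro: submonoid_gen.step)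
    then show ?thesis using bc(1) by blast
  next
    case 2
    then obtain b' c' where bc': "b' \<in> pos_braids" "c' \<in> pos_braids" "c * g = inverse b' * c'"
      using pos_braid_times_inverse_sigma[OF bc(2)] by blast
    have "x * g = inverse (b' * b) * c'"
      by (simp add: bc(3) mult.assoc bc'(3) pbraid.inverse_distrib_swap)
    then show ?thesis using bc' submonoid_gen_mult[OF bc'(1) bc(1)] by blast
  qed
qed

lemma braids_inverse: "x \<in> braids \<Longrightarrow> inverse x \<in> braids"
proof (induction rule: submonoid_gen.induct)
  case one
  show ?case by (simp add: submonoid_gen.one)
next
  case (step x g)
  then have "inverse g \<in> braids" by (auto intro: submonoid_gen_incl)
  then show ?case by (simp add: step.IH pbraid.inverse_distrib_swap submonoid_gen_mult)
qed

section \<open>Fractional decompositions\<close>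

abbreviation pos_thompson :: "pbraid set" where
  "pos_thompson \<equiv> submonoid_gen (range pb_a)"

text \<open>Each position of \<open>i\<close> relative to \<open>k\<close> falls under one relation,
  and in all of them exactly one letter \<open>pb_a\<close> survives on the right.\<close>

lemma pb_a_sigma_positive: "\<exists>s\<in>braids. \<exists>j. pb_a i * pb_sigma k = s * pb_a j"
proof -
  have s: "pb_sigma m \<in> braids" for m by (auto intro: submonoid_gen_incl)
  consider "i < k" | "k = i" | "i = Suc k" | "i \<ge> k + 2" by linarith
  then show ?thesis
  proof cases
    case 1
    then show ?thesis using pb_a_sigma s by blast
  next
    case 2
    then show ?thesis using pb_rel_eq(6)[of i] s submonoid_gen_mult[OF s s] by metis
  next
    case 3
    then show ?thesis using pb_rel_eq(7)[of k] s submonoid_gen_mult[OF s s] by (metis Suc_eq_plus1)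
  next
    case 4
    then show ?thesis using pb_rel_eq(2)[of k i] s by metis
  qed
qed

text \<open>The same relations are solved for the inverse letter, so the cases \<open>k = i\<close>
  and \<open>i = Suc k\<close> exchange their relations.\<close>

lemma pb_a_sigma_negative: "\<exists>s\<in>braids. \<exists>j. pb_a i * inverse (pb_sigma k) = s * pb_a j"
proof -
  have s: "pb_sigma m \<in> braids" for m by (auto intro: submonoid_gen_incl)
  have conclude: ?thesis if "pb_a j * pb_sigma k = s * pb_a i" "s \<in> braids" for s j
    using pbraid_inverse_conj[OF that(1)] braids_inverse[OF that(2)] by blast
  consider "i < k" | "k = i" | "i = Suc k" | "i \<ge> k + 2" by linarith
  then show ?thesis
  proof cases
    case 1
    then show ?thesis using conclude[OF pb_a_sigma s] by blast
  next
    case 2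
    then show ?thesis
      using conclude[of "k + 1" "pb_sigma k * pb_sigma (k + 1)"] pb_rel_eq(7)[of k] submonoid_gen_mult[OF s s]
      by simp
  next
    case 3
    then show ?thesis
      using conclude[of k "pb_sigma (k + 1) * pb_sigma k"] pb_rel_eq(6)[of k] submonoid_gen_mult[OF s s]
      by simp
  next
    case 4
    then show ?thesis using conclude[OF _ s] pb_rel_eq(2)[of k i] by metis
  qed
qed

text \<open>A single \<open>pb_a\<close> stays a single \<open>pb_a\<close> however many braid
  letters it crosses; this is what allows induction on the Thompson factor afterwards.\<close>

lemma pb_a_braid:
  assumes "s \<in> braids"
  shows "\<exists>s'\<in>braids. \<exists>j. pb_a i * s = s' * pb_a j"
  using assms
proof induction
  case one
  show ?case by (intro bexI[of _ 1] exI[of _ i]) (simp_all add: submonoid_gen.one)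
next
  case (step s g)
  then obtain s1 j where 1: "s1 \<in> braids" "pb_a i * s = s1 * pb_a j" by blast
  obtain s2 m where 2: "s2 \<in> braids" "pb_a j * g = s2 * pb_a m"
    using step.hyps(2) pb_a_sigma_positive pb_a_sigma_negative by blast
  have "pb_a i * (s * g) = (s1 * s2) * pb_a m" using 1(2) 2(2) by (metis mult.assoc)
  then show ?case using submonoid_gen_mult[OF 1(1) 2(1)] by blast
qed

lemma pos_thompson_braid:
  assumes "h \<in> pos_thompson" "s \<in> braids"
  shows "\<exists>s'\<in>braids. \<exists>h'\<in>pos_thompson. h * s = s' * h'"
  using assms
proof (induction arbitrary: s)
  case one
  then show ?case by (intro bexI[of _ s] bexI[of _ 1]) (simp_all add: submonoid_gen.one)
next
  case (step h g)
  then obtain s1 j where 1: "s1 \<in> braids" "g * s = s1 * pb_a j" using pb_a_braid by blast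
  obtain s2 h2 where 2: "s2 \<in> braids" "h2 \<in> pos_thompson" "h * s1 = s2 * h2"
    using step.IH[OF 1(1)] by blast
  have "h * g * s = s2 * (h2 * pb_a j)" using 1(2) 2(3) by (metis mult.assoc)
  then show ?case using 2(1) submonoid_gen.step[OF 2(2)] by blast
qed

lemma braid_inverse_pos_thompson:
  assumes "s \<in> braids" "h \<in> pos_thompson"
  shows "\<exists>h'\<in>pos_thompson. \<exists>s'\<in>braids. s * inverse h = inverse h' * s'"
proof -
  obtain s' h' where *: "s' \<in> braids" "h' \<in> pos_thompson" "h * inverse s = s' * h'"
    using pos_thompson_braid[OF assms(2) braids_inverse[OF assms(1)]] by blast
  have "inverse (h * inverse s) = inverse (s' * h')" by (simp only: *(3))
  then have "s * inverse h = inverse h' * inverse s'" by (simp add: pbraid.inverse_distrib_swap)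
  then show ?thesis using * braids_inverse by blast
qed

text \<open>Equal letters cancel, and distinct ones have the common left multiple given by
  \<open>pb_a_a\<close>. The inverse letter thus stays a single letter as it moves left, but its
  index changes, hence the generalization over \<open>k\<close>.\<close>

lemma pos_thompson_times_inverse_a:
  assumes "h \<in> pos_thompson"
  shows "\<exists>g\<in>pos_thompson. \<exists>h'\<in>pos_thompson. h * inverse (pb_a k) = inverse g * h'"
  using assms
proof (induction arbitrary: k)
  case one
  show ?case
    by (intro bexI[of _ "pb_a k"] bexI[of _ 1]) (simp_all add: submonoid_gen.one submonoid_gen_incl)
next
  case (step h g)
  then obtain i where i: "g = pb_a i" by blast
  show ?case
  proof (cases "k = i")
    case True
    then have "h * g * inverse (pb_a k) = inverse 1 * h" by (simp add: i mult.assoc)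
    then show ?thesis using step.hyps(1) submonoid_gen.one by blast
  next
    case False
    have "\<exists>k' i'. g * inverse (pb_a k) = inverse (pb_a k') * pb_a i'"
    proof (cases "i < k")
      case True
      from pbraid_inverse_conj[OF pb_a_a[OF this]] show ?thesis unfolding i by blast
    next
      case False
      with \<open>k \<noteq> i\<close> have "k < i" by simp
      from pbraid_inverse_conj[OF pb_a_a[OF this, symmetric]] show ?thesis unfolding i by blast
    qed
    then obtain k' i' where k': "g * inverse (pb_a k) = inverse (pb_a k') * pb_a i'" by blast
    obtain g2 h2 where 2: "g2 \<in> pos_thompson" "h2 \<in> pos_thompson"
        "h * inverse (pb_a k') = inverse g2 * h2"
      using step.IH by blast
    have "h * g * inverse (pb_a k) = inverse g2 * (h2 * pb_a i')" using k' 2(3) by (metis mult.assoc)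
    then show ?thesis using 2(1) submonoid_gen.step[OF 2(2)] by blast
  qed
qed

text \<open>The shape survives right multiplication by any letter: braid letters cross
  \<open>h\<close>; an inverse \<open>pb_a\<close> forms a fraction with \<open>h\<close>, whose
  denominator crosses the braid and joins \<open>h'\<close>.\<close>

lemma pbraid_thompson_braid_thompson:
  "\<exists>h'\<in>pos_thompson. \<exists>s\<in>braids. \<exists>h\<in>pos_thompson. x = inverse h' * s * h"
proof -
  have braid_step: "\<exists>h'\<in>pos_thompson. \<exists>s\<in>braids. \<exists>h\<in>pos_thompson. x * t = inverse h' * s * h"
    if x: "\<exists>h'\<in>pos_thompson. \<exists>s\<in>braids. \<exists>h\<in>pos_thompson. x = inverse h' * s * h"
      and t: "t \<in> braids" for x t
  proof -
    obtain h' s h where 1: "h' \<in> pos_thompson" "s \<in> braids" "h \<in> pos_thompson" "x = inverse h' * s * h"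
      using x by blast
    obtain s2 h2 where 2: "s2 \<in> braids" "h2 \<in> pos_thompson" "h * t = s2 * h2"
      using pos_thompson_braid[OF 1(3) t] by blast
    have "x * t = inverse h' * (s * s2) * h2" using 1(4) 2(3) by (metis mult.assoc)
    then show ?thesis using 1(1) 2(2) submonoid_gen_mult[OF 1(2) 2(1)] by blast
  qed
  show ?thesis
  proof (induction x rule: pbraid_induct)
    case one
    show ?case by (intro bexI[of _ 1]) (simp_all add: submonoid_gen.one)
  next
    case (sigma x i)
    then show ?case by (rule braid_step) (auto intro: submonoid_gen_incl)
  next
    case (sigma_inv x i)
    then show ?case by (rule braid_step) (auto intro: submonoid_gen_incl)
  next
    case (a x i)
    then obtain h' s h where 1: "h' \<in> pos_thompson" "s \<in> braids" "h \<in> pos_thompson"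
        "x = inverse h' * s * h" by blast
    have "x * pb_a i = inverse h' * s * (h * pb_a i)" by (simp only: 1(4) mult.assoc)
    then show ?case using 1(1,2) submonoid_gen.step[OF 1(3) rangeI] by blast
  next
    case (a_inv x i)
    then obtain h' s h where 1: "h' \<in> pos_thompson" "s \<in> braids" "h \<in> pos_thompson"
        "x = inverse h' * s * h" by blast
    obtain g2 h2 where 2: "g2 \<in> pos_thompson" "h2 \<in> pos_thompson"
        "h * inverse (pb_a i) = inverse g2 * h2"
      using pos_thompson_times_inverse_a[OF 1(3)] by blast
    obtain g3 s3 where 3: "g3 \<in> pos_thompson" "s3 \<in> braids" "s * inverse g2 = inverse g3 * s3"
      using braid_inverse_pos_thompson[OF 1(2) 2(1)] by blast
    have "x * inverse (pb_a i) = inverse h' * (s * inverse g2) * h2"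
      using 1(4) 2(3) by (simp add: mult.assoc)
    also have "\<dots> = inverse (g3 * h') * s3 * h2"
      by (simp add: 3(3) pbraid.inverse_distrib_swap mult.assoc)
    finally show ?case using 2(2) 3(2) submonoid_gen_mult[OF 3(1) 1(1)] by blast
  qed
qed

section \<open>Products of shifted special elements\<close>

text \<open>Nested form of \<open>asc_prod\<close>, suited to recursion because the whole tail is
  shifted at once.\<close>

fun shifted_prod :: "pbraid list \<Rightarrow> pbraid" where
  "shifted_prod [] = 1"
| "shifted_prod (z # zs) = z * pb_shift (shifted_prod zs)"

definition shifted_prods :: "pbraid set \<Rightarrow> pbraid set" where
  "shifted_prods C = shifted_prod ` lists C"

lemma shifted_prods_one: "1 \<in> shifted_prods C"
  unfolding shifted_prods_def by (rule image_eqI[of _ _ "[]"]) auto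

lemma shifted_prods_Cons: "z \<in> C \<Longrightarrow> y \<in> shifted_prods C \<Longrightarrow> z * pb_shift y \<in> shifted_prods C"
  unfolding shifted_prods_def by (force intro: image_eqI[of _ _ "z # _"])

text \<open>Since \<open>1\<close> lies in \<open>C\<close>, even the empty product splits, as
  \<open>1 * pb_shift 1\<close>.\<close>

lemma shifted_prods_cases:
  assumes "x \<in> shifted_prods C" "1 \<in> C"
  obtains z y where "z \<in> C" "y \<in> shifted_prods C" "x = z * pb_shift y"
proof -
  obtain zs where zs: "zs \<in> lists C" "x = shifted_prod zs"
    using assms(1) by (auto simp: shifted_prods_def)
  show thesis
  proof (cases zs)
    case Nil
    then show thesis using that[of 1 1] zs(2) assms(2) shifted_prods_one by simp
  next
    case (Cons z ys)
    then show thesis using that[of z "shifted_prod ys"] zs by (auto simp: shifted_prods_def)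
  qed
qed

text \<open>Index \<open>0\<close> affects only the first two factors: \<open>z, u\<close> become
  \<open>pb_bracket z u, z\<close>. A higher index acts on the tail, whence the generalization over
  \<open>x\<close>.\<close>

lemma shifted_prods_sigma:
  assumes "1 \<in> C" "\<And>x y. x \<in> C \<Longrightarrow> y \<in> C \<Longrightarrow> pb_bracket x y \<in> C" "x \<in> shifted_prods C"
  shows "x * pb_sigma k \<in> shifted_prods C"
  using assms(3)
proof (induction k arbitrary: x)
  case 0
  obtain z y where z: "z \<in> C" "y \<in> shifted_prods C" "x = z * pb_shift y"
    using shifted_prods_cases[OF 0 assms(1)] .
  obtain u v where u: "u \<in> C" "v \<in> shifted_prods C" "y = u * pb_shift v"
    using shifted_prods_cases[OF z(2) assms(1)] .
  have "x * pb_sigma 0 = z * pb_shift u * (pb_shift (pb_shift v) * pb_sigma 0)"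
    by (simp add: z u pb_shift_mult mult.assoc)
  \<comment> \<open>The trivial factor inserted here completes the bracket and leaves
    \<open>z\<close> as the second factor.\<close>
  also have "\<dots> = z * pb_shift u * pb_sigma 0 * (inverse (pb_shift z) * pb_shift z)
      * pb_shift (pb_shift v)"
    by (simp add: pb_shift2_sigma mult.assoc)
  also have "\<dots> = pb_bracket z u * pb_shift (z * pb_shift v)"
    by (simp only: pb_bracket_def pb_shift_mult mult.assoc)
  finally show ?case by (simp add: shifted_prods_Cons assms(2) z(1) u)
next
  case (Suc k)
  obtain z y where z: "z \<in> C" "y \<in> shifted_prods C" "x = z * pb_shift y"
    using shifted_prods_cases[OF Suc.prems assms(1)] .
  have "x * pb_sigma (Suc k) = z * pb_shift (y * pb_sigma k)"
    by (simp add: z(3) pb_shift_mult pb_shift_sigma mult.assoc)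
  then show ?case by (simp add: shifted_prods_Cons z(1) Suc.IH[OF z(2)])
qed

text \<open>Here the first two factors merge into one; passing \<open>pb_a 0\<close> to the left of
  the others lowers their shift by one, closing the gap.\<close>

lemma shifted_prods_a:
  assumes "1 \<in> C" "\<And>x y. x \<in> C \<Longrightarrow> y \<in> C \<Longrightarrow> pb_circ x y \<in> C" "x \<in> shifted_prods C"
  shows "x * pb_a k \<in> shifted_prods C"
  using assms(3)
proof (induction k arbitrary: x)
  case 0
  obtain z y where z: "z \<in> C" "y \<in> shifted_prods C" "x = z * pb_shift y"
    using shifted_prods_cases[OF 0 assms(1)] .
  obtain u v where u: "u \<in> C" "v \<in> shifted_prods C" "y = u * pb_shift v"
    using shifted_prods_cases[OF z(2) assms(1)] .
  have "x * pb_a 0 = pb_circ z u * pb_shift v"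
    by (simp add: z u pb_shift_mult mult.assoc pb_shift2_a pb_circ_def)
  then show ?case by (simp add: shifted_prods_Cons assms(2) z(1) u)
next
  case (Suc k)
  obtain z y where z: "z \<in> C" "y \<in> shifted_prods C" "x = z * pb_shift y"
    using shifted_prods_cases[OF Suc.prems assms(1)] .
  have "x * pb_a (Suc k) = z * pb_shift (y * pb_a k)"
    by (simp add: z(3) pb_shift_mult pb_shift_a mult.assoc)
  then show ?case by (simp add: shifted_prods_Cons z(1) Suc.IH[OF z(2)])
qed

lemma pos_braids_shifted_prods:
  assumes "1 \<in> C" "\<And>x y. x \<in> C \<Longrightarrow> y \<in> C \<Longrightarrow> pb_bracket x y \<in> C" "b \<in> pos_braids"
  shows "b \<in> shifted_prods C"
  using assms(3)
proof induction
  case (step b g)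
  then obtain k where "g = pb_sigma k" by blast
  then show ?case using shifted_prods_sigma[OF assms(1,2) step.IH] by simp
qed (rule shifted_prods_one)

text \<open>The initial factor \<open>b\<close> covers two uses: \<open>1\<close> for Thompson
  elements alone, and a positive braid for mixed products.\<close>

lemma pos_thompson_shifted_prods:
  assumes "1 \<in> C" "\<And>x y. x \<in> C \<Longrightarrow> y \<in> C \<Longrightarrow> pb_circ x y \<in> C"
    and "b \<in> shifted_prods C" "h \<in> pos_thompson"
  shows "b * h \<in> shifted_prods C"
  using assms(4)
proof induction
  case (step h g)
  then obtain k where "g = pb_a k" by blast
  then show ?case using shifted_prods_a[OF assms(1,2) step.IH] by (simp add: mult.assoc)
qed (simp add: assms(3))

section \<open>From lists of factors to indexed products\<close>

lemma pb_shift_prod_list: "pb_shift (prod_list xs) = prod_list (map pb_shift xs)"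
  by (induction xs) (simp_all add: pb_shift_mult)

lemma asc_prod_Suc: "asc_prod z (Suc n) = z 1 * pb_shift (asc_prod (\<lambda>k. z (Suc k)) n)"
proof -
  let ?f = "\<lambda>k. (pb_shift ^^ (k - 1)) (z k)"
  have upt: "[1..<Suc (Suc n)] = 1 # map Suc [1..<Suc n]"
    by (simp add: map_Suc_upt upt_conv_Cons del: upt_Suc)
  have "map (?f \<circ> Suc) [1..<Suc n]
      = map (pb_shift \<circ> (\<lambda>k. (pb_shift ^^ (k - 1)) (z (Suc k)))) [1..<Suc n]"
  proof (rule map_cong[OF HOL.refl])
    fix k assume "k \<in> set [1..<Suc n]"
    then have "k \<noteq> 0" by (auto simp del: upt_Suc)
    then obtain m where "k = Suc m" using not0_implies_Suc by blast
    then show "(?f \<circ> Suc) k = (pb_shift \<circ> (\<lambda>k. (pb_shift ^^ (k - 1)) (z (Suc k)))) k"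
      by simp
  qed
  moreover have "asc_prod z (Suc n) = z 1 * prod_list (map (?f \<circ> Suc) [1..<Suc n])"
    unfolding asc_prod_def upt by (simp del: upt_Suc)
  ultimately show ?thesis
    by (simp only: asc_prod_def pb_shift_prod_list map_map)
qed

lemma desc_inv_prod_eq: "desc_inv_prod z n = inverse (asc_prod z n)"
proof -
  have shift: "(pb_shift ^^ m) (inverse y) = inverse ((pb_shift ^^ m) y)" for m y
    by (induction m) (simp_all add: pb_shift_inverse)
  have "prod_list (map (\<lambda>k. inverse (f k)) (rev ks)) = inverse (prod_list (map f ks))"
    for f :: "nat \<Rightarrow> pbraid" and ks
    by (induction ks) (simp_all add: pbraid.inverse_distrib_swap)
  then show ?thesis unfolding desc_inv_prod_def asc_prod_def shift .
qed

text \<open>The offset \<open>k - 1\<close> reconciles factors numbered from \<open>1\<close> with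
  list positions; padding by \<open>1\<close> permits any larger length.\<close>

lemma asc_prod_nth:
  "length zs \<le> n \<Longrightarrow> asc_prod (\<lambda>k. if k - 1 < length zs then zs ! (k - 1) else 1) n = shifted_prod zs"
proof (induction n arbitrary: zs)
  case 0
  then show ?case by (simp add: asc_prod_def)
next
  case (Suc n)
  let ?pad = "\<lambda>zs k. if k - 1 < length zs then zs ! (k - 1) else (1 :: pbraid)"
  \<comment> \<open>\<open>asc_prod\<close> never reads index \<open>0\<close>, where truncated
    subtraction could make the sequences compared below differ.\<close>
  have cong: "asc_prod f n = asc_prod g n" if "\<And>k. k \<ge> 1 \<Longrightarrow> f k = g k" for f g
    unfolding asc_prod_def using that by (intro arg_cong[of _ _ prod_list] map_cong) auto
  show ?case
  proof (cases zs)
    case Nil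
    then show ?thesis using Suc.IH[of "[]"] by (simp add: asc_prod_Suc)
  next
    case (Cons z ys)
    have "asc_prod (\<lambda>k. ?pad zs (Suc k)) n = asc_prod (?pad ys) n"
      by (rule cong) (auto simp: Cons nth_Cons')
    also have "\<dots> = shifted_prod ys" using Suc Cons by simp
    finally show ?thesis by (simp add: asc_prod_Suc Cons)
  qed
qed

text \<open>One sequence represents \<open>x\<close> at every sufficiently large length, so several
  products can be brought to a common length.\<close>

lemma shifted_prods_asc_prod:
  assumes "x \<in> shifted_prods C" "1 \<in> C"
  obtains z N where "\<And>k. z k \<in> C" "\<And>n. n \<ge> N \<Longrightarrow> asc_prod z n = x"
proof -
  obtain zs where zs: "zs \<in> lists C" "x = shifted_prod zs"
    using assms(1) by (auto simp: shifted_prods_def)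
  show thesis
  proof (rule that)
    show "(if k - 1 < length zs then zs ! (k - 1) else 1) \<in> C" for k
      using zs(1) assms(2) by auto
    show "asc_prod (\<lambda>k. if k - 1 < length zs then zs ! (k - 1) else 1) n = x" if "n \<ge> length zs" for n
      using asc_prod_nth[OF that] zs(2) by simp
  qed
qed

theorem corollary3p23:
  fixes x :: pbraid
  shows "(\<exists>p q z z'. p \<ge> 1 \<and> q \<ge> 1 \<and>
            (\<forall>k\<in>{1..p}. z k \<in> special_pbraids) \<and>
            (\<forall>k\<in>{1..q}. z' k \<in> special_pbraids) \<and>
            x = desc_inv_prod z' q * asc_prod z p)
       \<and> (\<exists>n \<beta> \<beta>' h h'. n \<ge> 1 \<and>
            (\<forall>k\<in>{1..n}. \<beta> k \<in> special_braids \<and> \<beta>' k \<in> special_braids \<and>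
                        h k \<in> special_thompson \<and> h' k \<in> special_thompson) \<and>
            x = desc_inv_prod h' n * desc_inv_prod \<beta>' n * asc_prod \<beta> n * asc_prod h n)"
proof -
  obtain t' s t where 1: "t' \<in> pos_thompson" "s \<in> braids" "t \<in> pos_thompson" "x = inverse t' * s * t"
    using pbraid_thompson_braid_thompson by blast
  obtain b' b where 2: "b' \<in> pos_braids" "b \<in> pos_braids" "s = inverse b' * b"
    using braid_fraction[OF 1(2)] by blast
  have b: "c \<in> shifted_prods special_braids" if "c \<in> pos_braids" for c
    by (rule pos_braids_shifted_prods[OF _ _ that]) (auto intro: special_braids.intros)
  have t: "g \<in> shifted_prods special_thompson" if "g \<in> pos_thompson" for g
    using pos_thompson_shifted_prods[OF _ _ shifted_prods_one that, of special_thompson]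
    by (auto intro: special_thompson.intros)
  have bt: "c * g \<in> shifted_prods special_pbraids" if "c \<in> pos_braids" "g \<in> pos_thompson" for c g
    by (rule pos_thompson_shifted_prods[OF _ _ pos_braids_shifted_prods[OF _ _ that(1)] that(2)])
      (auto intro: special_pbraids.intros)
  \<comment> \<open>The same four factors serve both decompositions; here each positive braid is
    grouped with its neighbouring Thompson element.\<close>
  have first: "x = inverse (b' * t') * (b * t)"
    by (simp add: 1(4) 2(3) pbraid.inverse_distrib_swap mult.assoc)
  obtain z' q where z': "\<And>k. z' k \<in> special_pbraids" "\<And>n. n \<ge> q \<Longrightarrow> asc_prod z' n = b' * t'"
    using shifted_prods_asc_prod[OF bt[OF 2(1) 1(1)] special_pbraids.intros(1)] by blast
  obtain z p where z: "\<And>k. z k \<in> special_pbraids" "\<And>n. n \<ge> p \<Longrightarrow> asc_prod z n = b * t"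
    using shifted_prods_asc_prod[OF bt[OF 2(2) 1(3)] special_pbraids.intros(1)] by blast
  \<comment> \<open>The successors make both lengths positive.\<close>
  have "x = desc_inv_prod z' (Suc q) * asc_prod z (Suc p)"
    using first z'(2)[of "Suc q"] z(2)[of "Suc p"] by (simp add: desc_inv_prod_eq)
  then have A: "\<exists>p q z z'. p \<ge> 1 \<and> q \<ge> 1 \<and>
            (\<forall>k\<in>{1..p}. z k \<in> special_pbraids) \<and>
            (\<forall>k\<in>{1..q}. z' k \<in> special_pbraids) \<and>
            x = desc_inv_prod z' q * asc_prod z p"
    using z'(1) z(1) by (intro exI[of _ "Suc p"] exI[of _ "Suc q"] exI[of _ z] exI[of _ z']) simp
  obtain \<beta>' n1 where b1: "\<And>k. \<beta>' k \<in> special_braids" "\<And>n. n \<ge> n1 \<Longrightarrow> asc_prod \<beta>' n = b'"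
    using shifted_prods_asc_prod[OF b[OF 2(1)] special_braids.intros(1)] by blast
  obtain \<beta> n2 where b2: "\<And>k. \<beta> k \<in> special_braids" "\<And>n. n \<ge> n2 \<Longrightarrow> asc_prod \<beta> n = b"
    using shifted_prods_asc_prod[OF b[OF 2(2)] special_braids.intros(1)] by blast
  obtain h' n3 where h1: "\<And>k. h' k \<in> special_thompson" "\<And>n. n \<ge> n3 \<Longrightarrow> asc_prod h' n = t'"
    using shifted_prods_asc_prod[OF t[OF 1(1)] special_thompson.intros(1)] by blast
  obtain h n4 where h2: "\<And>k. h k \<in> special_thompson" "\<And>n. n \<ge> n4 \<Longrightarrow> asc_prod h n = t"
    using shifted_prods_asc_prod[OF t[OF 1(3)] special_thompson.intros(1)] by blast
  \<comment> \<open>Dominates all four thresholds and is positive.\<close>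
  define n where "n = Suc (n1 + n2 + n3 + n4)"
  have "x = desc_inv_prod h' n * desc_inv_prod \<beta>' n * asc_prod \<beta> n * asc_prod h n"
    using b1(2)[of n] b2(2)[of n] h1(2)[of n] h2(2)[of n]
    by (simp add: desc_inv_prod_eq n_def 1(4) 2(3) mult.assoc)
  then have "\<exists>n \<beta> \<beta>' h h'. n \<ge> 1 \<and>
            (\<forall>k\<in>{1..n}. \<beta> k \<in> special_braids \<and> \<beta>' k \<in> special_braids \<and>
                        h k \<in> special_thompson \<and> h' k \<in> special_thompson) \<and>
            x = desc_inv_prod h' n * desc_inv_prod \<beta>' n * asc_prod \<beta> n * asc_prod h n"
    using b1(1) b2(1) h1(1) h2(1)
    by (intro exI[of _ n] exI[of _ \<beta>] exI[of _ \<beta>'] exI[of _ h] exI[of _ h']) (simp add: n_def)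
  with A show ?thesis by blast
qed

end
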